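(* Let $R$ be a proper $*$-ring and let $a,b\in R$ be central weak core invertible with $ab=0=ba$ and $a^*b=0$. Then $a+b$ is central weak core invertible and $(a+b)^{\boxminus}=a^{\boxminus}+b^{\boxminus}$.
   Context: A proper $*$-ring is a (not necessarily commutative) ring $R$ with unit $1\ne 0$ and an involution $r\mapsto r^*$ satisfying $(r^* )^*=r$, $(r+s)^*=r^*+s^*$, $(rs)^*=s^*r^*$, such that $r^*r=0$ implies $r=0$. $C(R)$ denotes the center of $R$. A central weak core inverse of $a\in R$ is an element $x\in R$ with $ax\in C(R)$, $xa^{k+1}=a^k$ for some integer $k\ge 1$, $xax=x$ and $(ax)^*=ax$. It is unique if it exists and is denoted $a^{\boxminus}$; $a$ is then called central weak core invertible. *)

theory Defs
  imports Main
begin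

class star_ring = ring_1 +
  fixes star :: "'a \<Rightarrow> 'a"
  assumes star_star [simp]: "star (star r) = r"
    and star_add: "star (r + s) = star r + star s"
    and star_mult: "star (r * s) = star s * star r"

class proper_star_ring = star_ring +
  assumes star_mult_self_eq_0: "star r * r = 0 \<Longrightarrow> r = 0"

definition ring_center :: "'a::ring_1 set" where
  "ring_center = {c. \<forall>r. c * r = r * c}"

definition is_cwc_inverse :: "'a::proper_star_ring \<Rightarrow> 'a \<Rightarrow> bool" where
  "is_cwc_inverse a x \<longleftrightarrow>
     a * x \<in> ring_center \<and>
     (\<exists>k\<ge>1. x * a ^ (k + 1) = a ^ k) \<and>
     x * a * x = x \<and>
     star (a * x) = a * x"

definition cwc_invertible :: "'a::proper_star_ring \<Rightarrow> bool" where
  "cwc_invertible a \<longleftrightarrow> (\<exists>x. is_cwc_inverse a x)"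

text \<open>The central weak core inverse is unique when it exists, so the definite description
  below denotes it for every central weak core invertible element; on other elements its value
  is unspecified.\<close>

definition cwc_inverse :: "'a::proper_star_ring \<Rightarrow> 'a" where
  "cwc_inverse a = (THE x. is_cwc_inverse a x)"

end

theory Submission
  imports Defs
begin

text \<open>
  A central weak core inverse \<open>x\<close> of \<open>a\<close> commutes with \<open>a\<close>: since \<open>e = a * x\<close> is a central
  idempotent with \<open>e * x = x\<close>, one gets \<open>a ^ k * x ^ k = e\<close> for \<open>k \<ge> 1\<close>, and multiplying
  \<open>x * a ^ (k + 1) = a ^ k\<close> by \<open>x ^ k\<close> on the right leaves \<open>x * a = e\<close>.
  So \<open>a\<close> is invertible in the corner \<open>e R\<close> with inverse \<open>x\<close>, and nilpotent in the
  complementary corner \<open>(1 - e) R\<close>. The idempotent \<open>e\<close> is determined by \<open>a\<close>, because it generates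
  the same right ideal as every high power of \<open>a\<close>; hence \<open>x\<close> is unique.

  If moreover \<open>y\<close> is a central weak core inverse of \<open>b\<close>, then \<open>x = x * x * a = a * x * x\<close> and
  \<open>y = y * y * b = b * y * y\<close>, so \<open>a * b = 0 = b * a\<close> makes every mixed product of one of
  \<open>a, x\<close> with one of \<open>b, y\<close> vanish. Sums and products then split into an \<open>a\<close>-part and a
  \<open>b\<close>-part, and each defining condition for \<open>x + y\<close> is the sum of those for \<open>x\<close> and \<open>y\<close>.
\<close>

lemma is_cwc_inverseD:
  assumes "is_cwc_inverse a x"
  shows "a * x * r = r * (a * x)" and "x * a * x = x" and "star (a * x) = a * x"
  using assms unfolding is_cwc_inverse_def ring_center_def by blast+

lemma cwc_inverse_mult_power:
  assumes "is_cwc_inverse a x"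
  shows "a ^ Suc n * x ^ Suc n = a * x"
proof (induction n)
  case 0
  then show ?case by simp
next
  case (Suc n)
  have fixed: "a * x * x = x"
    by (metis is_cwc_inverseD(1,2)[OF assms] mult.assoc)
  have "a ^ Suc (Suc n) * x ^ Suc (Suc n) = a * (a ^ Suc n * x ^ Suc n) * x"
    by (metis power_Suc power_Suc2 mult.assoc)
  also have "\<dots> = a * (a * x * x)"
    by (simp only: Suc.IH mult.assoc)
  also have "\<dots> = a * x"
    by (simp only: fixed)
  finally show ?case .
qed

text \<open>
  The condition \<open>x * a ^ (k + 1) = a ^ k\<close> makes \<open>x\<close> a left inverse of \<open>a\<close> on the powers from
  \<open>a ^ k\<close> onwards only. Since \<open>a ^ k\<close> times \<open>x ^ k\<close> is the central idempotent \<open>a * x\<close>, multiplying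
  by \<open>x ^ k\<close> turns this into a left inverse on the whole corner of that idempotent.
\<close>

lemma cwc_inverse_commute:
  assumes "is_cwc_inverse a x"
  shows "x * a = a * x"
proof -
  obtain k where k: "k \<ge> 1" "x * a ^ (k + 1) = a ^ k"
    using assms by (auto simp: is_cwc_inverse_def)
  have cancel: "a ^ k * x ^ k = a * x"
    using cwc_inverse_mult_power[OF assms, of "k - 1"] k(1) by simp
  have "a * x = x * a ^ (k + 1) * x ^ k"
    by (simp only: k(2) cancel)
  also have "\<dots> = x * a * (a ^ k * x ^ k)"
    by (simp add: mult.assoc)
  also have "\<dots> = x * (a * (a * x))"
    by (simp only: cancel mult.assoc)
  also have "\<dots> = x * (a * x * a)"
    by (simp only: is_cwc_inverseD(1)[OF assms, of a])
  also have "\<dots> = x * a"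
    using is_cwc_inverseD(2)[OF assms] by (metis mult.assoc)
  finally show ?thesis ..
qed

text \<open>The witness \<open>k\<close> may be enlarged, so two elements can be treated with a common exponent.\<close>

lemma cwc_inverse_power_raise:
  fixes a x :: "'a::monoid_mult"
  assumes "x * a ^ (k + 1) = a ^ k"
  shows "x * a ^ (k + m + 1) = a ^ (k + m)"
proof -
  have "x * a ^ (k + m + 1) = x * a ^ (k + 1) * a ^ m"
    by (simp only: mult.assoc power_add[symmetric] add_ac)
  then show ?thesis
    by (simp only: assms power_add[symmetric])
qed

text \<open>
  For large \<open>k\<close>, \<open>a * y\<close> fixes \<open>a ^ k\<close> under left multiplication, and \<open>a * x\<close> is a right
  multiple of \<open>a ^ k\<close>.
\<close>

lemma cwc_inverse_idem_absorb:
  assumes x: "is_cwc_inverse a x" and y: "is_cwc_inverse a y"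
  shows "a * y * (a * x) = a * x"
proof -
  obtain k where k: "k \<ge> 1" "y * a ^ (k + 1) = a ^ k"
    using y by (auto simp: is_cwc_inverse_def)
  have cancel: "a ^ k * x ^ k = a * x"
    using cwc_inverse_mult_power[OF x, of "k - 1"] k(1) by simp
  have "a * y * a ^ k = y * a ^ (k + 1)"
    by (simp add: cwc_inverse_commute[OF y, symmetric] mult.assoc[symmetric])
  then have "a * y * a ^ k = a ^ k"
    using k(2) by simp
  then show ?thesis
    by (metis cancel mult.assoc)
qed

lemma cwc_inverse_unique:
  assumes x: "is_cwc_inverse a x" and y: "is_cwc_inverse a y"
  shows "x = y"
proof -
  have "a * y * (a * x) = a * x * (a * y)"
    by (rule is_cwc_inverseD(1)[OF x, symmetric])
  then have idem_eq: "a * x = a * y"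
    using cwc_inverse_idem_absorb[OF x y] cwc_inverse_idem_absorb[OF y x] by simp
  \<comment> \<open>Uniqueness of inverses in the common corner \<open>e R\<close>: \<open>x = x * (a * y) = (x * a) * y = y\<close>.\<close>
  have "x = x * a * y"
    using is_cwc_inverseD(2)[OF x] idem_eq by (metis mult.assoc)
  also have "\<dots> = y * a * y"
    using idem_eq cwc_inverse_commute[OF x] cwc_inverse_commute[OF y] by simp
  also have "\<dots> = y"
    by (rule is_cwc_inverseD(2)[OF y])
  finally show ?thesis .
qed

lemma cwc_inverse_eqI: "is_cwc_inverse a x \<Longrightarrow> cwc_inverse a = x"
  unfolding cwc_inverse_def by (blast intro: the_equality cwc_inverse_unique)

text \<open>
  Commutation makes \<open>x\<close> both a left and a right multiple of \<open>a\<close>, so it inherits the one-sided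
  annihilators of \<open>a\<close>.
\<close>

lemma cwc_inverse_annihilate:
  assumes "is_cwc_inverse a x"
  shows "c * a = 0 \<Longrightarrow> c * x = 0" and "a * c = 0 \<Longrightarrow> x * c = 0"
proof -
  have "x * a * x = x" and comm: "x * a = a * x"
    using is_cwc_inverseD(2)[OF assms] cwc_inverse_commute[OF assms] by simp_all
  then have left: "x = a * (x * x)" and right: "x = x * x * a"
    by (metis mult.assoc)+
  show "c * x = 0" if "c * a = 0"
    using that left by (metis mult.assoc mult_zero_left)
  show "x * c = 0" if "a * c = 0"
    using that right by (metis mult.assoc mult_zero_right)
qed

lemma power_Suc_add_orthogonal:
  fixes a b :: "'a::semiring_1"
  assumes "a * b = 0" "b * a = 0"
  shows "(a + b) ^ Suc n = a ^ Suc n + b ^ Suc n"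
proof (induction n)
  case 0
  then show ?case by simp
next
  case (Suc n)
  have "a * b ^ Suc n = 0" "b * a ^ Suc n = 0"
    using assms by (simp_all add: mult.assoc[symmetric])
  then show ?case
    by (simp add: power_Suc[of _ "Suc n"] Suc.IH distrib_left distrib_right del: power_Suc)
qed

lemma is_cwc_inverse_add:
  assumes x: "is_cwc_inverse a x" and y: "is_cwc_inverse b y"
    and ab: "a * b = 0" and ba: "b * a = 0"
  shows "is_cwc_inverse (a + b) (x + y)"
proof -
  have ay: "a * y = 0" and ya: "y * a = 0"
    using cwc_inverse_annihilate[OF y] ab ba by blast+
  have bx: "b * x = 0" and xb: "x * b = 0"
    using cwc_inverse_annihilate[OF x] ab ba by blast+
  have prod: "(a + b) * (x + y) = a * x + b * y"
    by (simp add: distrib_left distrib_right ay bx)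
  have prod': "(x + y) * (a + b) = x * a + y * b"
    by (simp add: distrib_left distrib_right ya xb)
  have "(a + b) * (x + y) \<in> ring_center"
    unfolding prod ring_center_def
    by (simp add: distrib_left distrib_right is_cwc_inverseD(1)[OF x] is_cwc_inverseD(1)[OF y])
  moreover have "star ((a + b) * (x + y)) = (a + b) * (x + y)"
    unfolding prod by (simp only: star_add is_cwc_inverseD(3)[OF x] is_cwc_inverseD(3)[OF y])
  moreover have "(x + y) * (a + b) * (x + y) = x + y"
    unfolding prod' using is_cwc_inverseD(2)[OF x] is_cwc_inverseD(2)[OF y]
    by (simp add: distrib_left distrib_right mult.assoc ay bx)
  moreover have "\<exists>n\<ge>1. (x + y) * (a + b) ^ (n + 1) = (a + b) ^ n"
  proof -
    obtain k where k: "k \<ge> 1" "x * a ^ (k + 1) = a ^ k"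
      using x by (auto simp: is_cwc_inverse_def)
    obtain l where l: "l \<ge> 1" "y * b ^ (l + 1) = b ^ l"
      using y by (auto simp: is_cwc_inverse_def)
    define n where "n = k + l"
    have n: "n \<ge> 1" using k(1) by (simp add: n_def)
    have powers: "(a + b) ^ m = a ^ m + b ^ m" if "m \<ge> 1" for m
      using power_Suc_add_orthogonal[OF ab ba, of "m - 1"] that by simp
    have "x * a ^ (n + 1) = a ^ n"
      using cwc_inverse_power_raise[OF k(2), of l] by (simp only: n_def)
    moreover have "y * b ^ (n + 1) = b ^ n"
      using cwc_inverse_power_raise[OF l(2), of k] by (simp only: n_def add.commute[of k l])
    moreover have "x * b ^ (n + 1) = 0" "y * a ^ (n + 1) = 0"
      using xb ya by (simp_all add: mult.assoc[symmetric])
    ultimately have "(x + y) * (a + b) ^ (n + 1) = (a + b) ^ n"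
      using n powers[of n] powers[of "n + 1"]
      by (simp add: distrib_left distrib_right del: power_Suc)
    with n show ?thesis by blast
  qed
  ultimately show ?thesis
    unfolding is_cwc_inverse_def by blast
qed

theorem theorem4p18:
  fixes a b :: "'a::proper_star_ring"
  assumes "cwc_invertible a" and "cwc_invertible b"
    and "a * b = 0" and "b * a = 0"
    and "star a * b = 0"
  shows "cwc_invertible (a + b) \<and> cwc_inverse (a + b) = cwc_inverse a + cwc_inverse b"
proof -
  obtain x y where x: "is_cwc_inverse a x" and y: "is_cwc_inverse b y"
    using assms by (auto simp: cwc_invertible_def)
  have "is_cwc_inverse (a + b) (x + y)"
    using is_cwc_inverse_add[OF x y] assms by simp
  then show ?thesis
    using cwc_inverse_eqI x y by (auto simp: cwc_invertible_def)
qed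

end
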